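(* Let $\alpha,\alpha'$ be irrational numbers, let $q_n$ and $q_n'$ be the denominators of the convergents of the continued fraction expansions of $\alpha$ and $\alpha'$ respectively, and let $T_{(\alpha,\alpha')}$ be the translation by the vector $(\alpha,\alpha')$ on $\mathbb{T}^2=\mathbb{R}^2/\mathbb{Z}^2$. Suppose that for some $\gamma>1$ the inequalities $$q_n'\ge q_n^{\gamma},\qquad q_{n+1}\ge (q_n')^{\gamma}$$ hold for all sufficiently large $n$. Then for each $x_0\in\mathbb{T}^2$, $$\liminf_{r\to 0}\frac{\log\tau_r(x,x_0)}{-\log r}\ge\gamma$$ holds for Lebesgue-almost every $x\in\mathbb{T}^2$.
   Context: For a map $T:X\to X$ on a metric space, $\tau_r(x,x_0)=\min\{n\ge 1: T^n(x)\in B_r(x_0)\}$ is the hitting time of the ball of radius $r$ centered at $x_0$; if $\tau_r(x,x_0)$ is undefined for some $r$, the lower and upper limits of $\frac{\log\tau_r(x,x_0)}{-\log r}$ as $r\to0$ are set equal to $\infty$. Here $T=T_{(\alpha,\alpha')}$, and $\mathbb{T}^2$ carries the sup distance $\mathrm{dist}(x,y)=\max_i\|x_i-y_i\|$, where $\|t\|$ is the distance of $t$ from the nearest integer. For $\alpha=[a_0;a_1,a_2,\dots]$ the denominators of the convergents are given by $q_{-1}=0$, $q_0=1$, $q_{k+1}=a_{k+1}q_k+q_{k-1}$ for $k\ge0$. *)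

theory Defs
  imports "HOL-Analysis.Analysis"
begin

subsection \<open>Continued fractions\<close>

text \<open>Complete quotients of \<open>x\<close>. For irrational \<open>x\<close> no \<open>frac\<close> below vanishes, so the division is
  genuine.\<close>

fun cf_rem :: "real \<Rightarrow> nat \<Rightarrow> real" where
  "cf_rem x 0 = x"
| "cf_rem x (Suc n) = 1 / frac (cf_rem x n)"

definition cf_quot :: "real \<Rightarrow> nat \<Rightarrow> int" where
  "cf_quot x n = \<lfloor>cf_rem x n\<rfloor>"

text \<open>The second equation is the recurrence \<open>q (k+1) = a (k+1) * q k + q (k-1)\<close> at \<open>k = 0\<close>,
  with the convention \<open>q (-1) = 0\<close>.\<close>

fun cf_denom :: "real \<Rightarrow> nat \<Rightarrow> int" where
  "cf_denom x 0 = 1"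
| "cf_denom x (Suc 0) = cf_quot x 1 * cf_denom x 0 + 0"
| "cf_denom x (Suc (Suc k)) = cf_quot x (Suc (Suc k)) * cf_denom x (Suc k) + cf_denom x k"


subsection \<open>Distance to the nearest integer\<close>

definition int_dist :: "real \<Rightarrow> real" where
  "int_dist t = \<bar>t - of_int (round t)\<bar>"

lemma int_dist_nonneg: "0 \<le> int_dist t"
  by (simp add: int_dist_def)

lemma int_dist_le: "int_dist t \<le> \<bar>t - of_int k\<bar>"
  unfolding int_dist_def by (rule round_diff_minimal)

lemma int_dist_le_abs: "int_dist t \<le> \<bar>t\<bar>"
  using int_dist_le[of t 0] by simp

lemma int_dist_eq_0_iff: "int_dist t = 0 \<longleftrightarrow> t \<in> \<int>"
proof
  assume "int_dist t = 0"
  then have "t = of_int (round t)" by (simp add: int_dist_def)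
  then show "t \<in> \<int>" by (metis Ints_of_int)
next
  assume "t \<in> \<int>"
  then show "int_dist t = 0" by (auto simp: int_dist_def elim: Ints_cases)
qed

lemma int_dist_minus: "int_dist (- t) = int_dist t"
proof -
  have "int_dist (- s) \<le> int_dist s" for s
    using int_dist_le[of "- s" "- round s"] by (simp add: int_dist_def abs_minus_commute)
  from this[of t] this[of "- t"] show ?thesis by simp
qed

lemma int_dist_triangle: "int_dist (s + t) \<le> int_dist s + int_dist t"
  using int_dist_le[of "s + t" "round s + round t"] by (simp add: int_dist_def)

lemma int_dist_cong:
  assumes "s - t \<in> \<int>"
  shows "int_dist s = int_dist t"
  using int_dist_triangle[of t "s - t"] int_dist_triangle[of s "t - s"] assms
    int_dist_eq_0_iff[of "s - t"] int_dist_minus[of "s - t"] by simp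


subsection \<open>The two-dimensional torus\<close>

definition torus_rel :: "real \<times> real \<Rightarrow> real \<times> real \<Rightarrow> bool" where
  "torus_rel x y \<longleftrightarrow> fst x - fst y \<in> \<int> \<and> snd x - snd y \<in> \<int>"

lemma equivp_torus_rel: "equivp torus_rel"
proof (rule equivpI)
  show "reflp torus_rel" by (simp add: reflp_def torus_rel_def)
  show "symp torus_rel"
    unfolding symp_def torus_rel_def by (metis Ints_minus minus_diff_eq)
  show "transp torus_rel"
    unfolding transp_def torus_rel_def by (metis Ints_add diff_add_cancel add_diff_eq)
qed

quotient_type torus = "real \<times> real" / torus_rel
  by (rule equivp_torus_rel)

lift_definition torus_proj :: "real \<times> real \<Rightarrow> torus" is "\<lambda>x. x" .

lift_definition translation :: "real \<times> real \<Rightarrow> torus \<Rightarrow> torus" is "\<lambda>v x. x + v"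
  by (simp add: torus_rel_def)

instantiation torus :: metric_space
begin

lift_definition dist_torus :: "torus \<Rightarrow> torus \<Rightarrow> real" is
  "\<lambda>x y. max (int_dist (fst x - fst y)) (int_dist (snd x - snd y))"
proof -
  have *: "int_dist (a - c) = int_dist (b - d)" if "a - b \<in> \<int>" "c - d \<in> \<int>" for a b c d :: real
    using Ints_diff[OF that] by (intro int_dist_cong) (simp add: algebra_simps)
  fix x x' y y' :: "real \<times> real"
  assume "torus_rel x x'" "torus_rel y y'"
  then show "max (int_dist (fst x - fst y)) (int_dist (snd x - snd y)) =
    max (int_dist (fst x' - fst y')) (int_dist (snd x' - snd y'))"
    using *[of "fst x" "fst x'" "fst y" "fst y'"] *[of "snd x" "snd x'" "snd y" "snd y'"]
    by (simp add: torus_rel_def)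
qed

definition uniformity_torus :: "(torus \<times> torus) filter" where
  "uniformity_torus = (INF e\<in>{0 <..}. principal {(x, y). dist x y < e})"

definition open_torus :: "torus set \<Rightarrow> bool" where
  "open_torus U \<longleftrightarrow> (\<forall>x\<in>U. \<forall>\<^sub>F (x', y) in uniformity. x' = x \<longrightarrow> y \<in> U)"

instance
proof
  fix x y z :: torus
  show "dist x y = 0 \<longleftrightarrow> x = y"
  proof transfer
    fix x y :: "real \<times> real"
    show "max (int_dist (fst x - fst y)) (int_dist (snd x - snd y)) = 0 \<longleftrightarrow> torus_rel x y"
      using int_dist_nonneg[of "fst x - fst y"] int_dist_nonneg[of "snd x - snd y"]
      by (auto simp: torus_rel_def max_def int_dist_eq_0_iff[symmetric])
  qed
  show "dist x y \<le> dist x z + dist y z"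
  proof transfer
    fix x y z :: "real \<times> real"
    have "int_dist (a - b) \<le> int_dist (a - c) + int_dist (b - c)" for a b c :: real
      using int_dist_triangle[of "a - c" "c - b"] int_dist_minus[of "c - b"] by simp
    from this[of "fst x" "fst y" "fst z"] this[of "snd x" "snd y" "snd z"]
    show "max (int_dist (fst x - fst y)) (int_dist (snd x - snd y))
      \<le> max (int_dist (fst x - fst z)) (int_dist (snd x - snd z))
        + max (int_dist (fst y - fst z)) (int_dist (snd y - snd z))"
      by linarith
  qed
qed (fact uniformity_torus_def open_torus_def)+

end

text \<open>Lebesgue measure on the torus is the image of planar Lebesgue measure on the fundamental
  domain. It is taken on the Borel sets; completing it would not change what holds almost
  everywhere.\<close>

definition torus_lebesgue :: "torus measure" where
  "torus_lebesgue = distr (restrict_space lborel ({0..<1} \<times> {0..<1})) borel torus_proj"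

lemma dist_torus_proj_le: "dist (torus_proj x) (torus_proj y) \<le> dist x y"
proof transfer
  fix x y :: "real \<times> real"
  have "\<bar>fst x - fst y\<bar> \<le> dist x y" "\<bar>snd x - snd y\<bar> \<le> dist x y"
    using dist_fst_le[of x y] dist_snd_le[of x y] by (simp_all add: dist_real_def)
  then show "max (int_dist (fst x - fst y)) (int_dist (snd x - snd y)) \<le> dist x y"
    using int_dist_le_abs[of "fst x - fst y"] int_dist_le_abs[of "snd x - snd y"] by simp
qed

lemma continuous_on_torus_proj: "continuous_on A torus_proj"
  unfolding continuous_on_iff by (meson dist_torus_proj_le le_less_trans)

lemma measurable_torus_proj:
  "torus_proj \<in> measurable (restrict_space lborel ({0..<1} \<times> {0..<1})) borel"
proof -
  have "torus_proj \<in> borel_measurable lborel"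
    by (simp add: borel_measurable_continuous_onI continuous_on_torus_proj)
  then show ?thesis by (rule measurable_restrict_space1)
qed

lemma emeasure_torus_lebesgue_UNIV: "emeasure torus_lebesgue UNIV = 1"
proof -
  have S: "{0..<1::real} \<times> {0..<1::real} \<in> sets borel"
    by (intro borel_Times) auto
  have "emeasure torus_lebesgue UNIV = emeasure lborel ({0..<1::real} \<times> {0..<1::real})"
    unfolding torus_lebesgue_def using S
    by (simp add: emeasure_distr measurable_torus_proj emeasure_restrict_space space_restrict_space)
  also have "\<dots> = 1"
    by (simp add: lborel_prod[symmetric] lborel.emeasure_pair_measure_Times)
  finally show ?thesis .
qed


subsection \<open>Hitting times\<close>

definition hits :: "('a::metric_space \<Rightarrow> 'a) \<Rightarrow> real \<Rightarrow> 'a \<Rightarrow> 'a \<Rightarrow> bool" where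
  "hits T r x x0 \<longleftrightarrow> (\<exists>n\<ge>1. (T ^^ n) x \<in> ball x0 r)"

text \<open>Meaningful only if \<open>hits T r x x0\<close>.\<close>

definition hitting_time :: "('a::metric_space \<Rightarrow> 'a) \<Rightarrow> real \<Rightarrow> 'a \<Rightarrow> 'a \<Rightarrow> nat" where
  "hitting_time T r x x0 = (LEAST n. n \<ge> 1 \<and> (T ^^ n) x \<in> ball x0 r)"

definition lower_hitting_exponent :: "('a::metric_space \<Rightarrow> 'a) \<Rightarrow> 'a \<Rightarrow> 'a \<Rightarrow> ereal" where
  "lower_hitting_exponent T x x0 =
    (if \<forall>r>0. hits T r x x0
     then Liminf (at_right 0) (\<lambda>r. ereal (ln (real (hitting_time T r x x0)) / (- ln r)))
     else \<infinity>)"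

end

theory Submission
  imports Defs
begin

text \<open>
  The orbit of a rotation by \<open>a\<close> of the circle is badly distributed when \<open>a\<close> has a good rational
  approximation: if \<open>q * a\<close> is within \<open>1 / Q\<close> of an integer, then the first \<open>N\<close> orbit points
  stay within \<open>N / (q * Q)\<close> of the first \<open>q\<close> of them. The \<open>r\<close>-neighbourhood of these \<open>N\<close> points
  therefore has measure \<open>O (q * r + N / Q)\<close>, whatever the size of \<open>N * r\<close>. On the torus either
  coordinate can be used to bound the measure of the points that visit a ball of radius \<open>r\<close>
  before time \<open>N\<close> (\<open>measure_visitors_le\<close>).

  The hypotheses say that the denominators interlace as \<open>q n, q' n, q (n + 1), q' (n + 1), \<dots>\<close> and
  that each is at least the \<open>\<gamma>\<close>-th power of its predecessor. Let a large real \<open>y\<close> fall between two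
  neighbours in this list, and let \<open>q\<close> be the left one. The denominator \<open>Q\<close> that follows \<open>q\<close> in the
  \<^emph>\<open>same\<close> continued fraction is two places further on; it is at least the \<open>\<gamma>\<close>-th power of the
  right neighbour of \<open>y\<close>, so \<open>q \<le> y\<close> and \<open>Q \<ge> y powr \<gamma>\<close>
  (\<open>scale_between_denominators\<close>). With \<open>r = y powr - s\<close> and \<open>N = y powr t\<close> the bound becomes
  \<open>O (y powr (1 - s) + y powr (t - \<gamma>))\<close>, a negative power of \<open>y\<close> whenever \<open>s > 1\<close> and
  \<open>t < \<gamma>\<close>. Along \<open>y = 2 ^ k\<close> these measures are summable, and the Borel--Cantelli lemma shows that
  almost every point needs time more than \<open>y powr t\<close> to reach the ball of radius \<open>y powr - s\<close>, for
  all large \<open>k\<close>. Interpolating between consecutive \<open>k\<close> costs only a constant factor in \<open>r\<close>, so the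
  lower hitting exponent is at least every \<open>\<beta> < t / s\<close>; finally \<open>t / s\<close> can be taken as close to
  \<open>\<gamma>\<close> as desired.
\<close>

section \<open>Approximation by convergents\<close>

lemma cf_rem_irrational:
  assumes "x \<notin> \<rat>"
  shows "cf_rem x n \<notin> \<rat>"
proof (induction n)
  case 0
  then show ?case using assms by simp
next
  case (Suc n)
  have "cf_rem x n \<in> \<rat>" if "1 / frac (cf_rem x n) \<in> \<rat>"
  proof -
    have "frac (cf_rem x n) \<in> \<rat>"
      using Rats_inverse[OF that] by simp
    then have "frac (cf_rem x n) + of_int \<lfloor>cf_rem x n\<rfloor> \<in> \<rat>"
      by (intro Rats_add) auto
    then show ?thesis by (simp add: frac_def)
  qed
  then show ?case using Suc by auto
qed

lemma frac_cf_rem_pos: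
  assumes "x \<notin> \<rat>"
  shows "frac (cf_rem x n) > 0"
  using cf_rem_irrational[OF assms, of n] Ints_subset_Rats by (auto simp: frac_gt_0_iff)

lemma cf_quot_Suc_ge_1:
  assumes "x \<notin> \<rat>"
  shows "cf_quot x (Suc n) \<ge> 1"
  using frac_cf_rem_pos[OF assms, of n] frac_lt_1[of "cf_rem x n"]
  by (simp add: cf_quot_def le_floor_iff field_simps)

text \<open>The linear lower bound is a crude form of Fibonacci growth; only unboundedness matters.\<close>

lemma cf_denom_lower_bound:
  assumes "x \<notin> \<rat>"
  shows "cf_denom x n \<ge> 1 \<and> cf_denom x n \<ge> int n"
proof (induction n rule: less_induct)
  case (less n)
  consider "n = 0" | "n = 1" | k where "n = Suc (Suc k)"
    by (metis One_nat_def not0_implies_Suc)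
  then show ?case
  proof cases
    case 3
    have q: "cf_denom x k \<ge> 1" "cf_denom x (Suc k) \<ge> 1" "cf_denom x (Suc k) \<ge> int (Suc k)"
      using less[of k] less[of "Suc k"] 3 by auto
    have "1 * cf_denom x (Suc k) \<le> cf_quot x (Suc (Suc k)) * cf_denom x (Suc k)"
      using q cf_quot_Suc_ge_1[OF assms, of "Suc k"] by (intro mult_right_mono) auto
    then have "cf_denom x (Suc k) + 1 \<le> cf_denom x (Suc (Suc k))"
      using q(1) by simp
    then show ?thesis using q(3) 3 by (simp del: cf_denom.simps)
  qed (use cf_quot_Suc_ge_1[OF assms, of 0] in auto)
qed

text \<open>The absolute value of the error \<open>q n * x - p n\<close> of the \<open>n\<close>-th convergent. The product form
  gives its sign and makes the recurrence below a statement about a single fractional part.\<close>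

definition cf_error :: "real \<Rightarrow> nat \<Rightarrow> real" where
  "cf_error x n = (\<Prod>i\<le>n. frac (cf_rem x i))"

lemma cf_error_nonneg: "cf_error x n \<ge> 0"
  by (simp add: cf_error_def prod_nonneg)

lemma cf_error_1:
  assumes "x \<notin> \<rat>"
  shows "cf_error x (Suc 0) = 1 - real_of_int (cf_quot x (Suc 0)) * cf_error x 0"
  using frac_cf_rem_pos[OF assms, of 0]
  by (simp add: cf_error_def cf_quot_def frac_def[of "1 / frac x"] field_simps)

lemma cf_error_recurrence:
  assumes "x \<notin> \<rat>"
  shows "cf_error x (Suc (Suc n)) =
    cf_error x n - real_of_int (cf_quot x (Suc (Suc n))) * cf_error x (Suc n)"
proof -
  define f where "f = frac (cf_rem x (Suc n))"
  have f: "f > 0" unfolding f_def by (rule frac_cf_rem_pos[OF assms])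
  have rem: "cf_rem x (Suc (Suc n)) = 1 / f" by (simp add: f_def)
  have 1: "cf_error x (Suc n) = cf_error x n * f"
    by (simp add: cf_error_def f_def)
  have 2: "cf_error x (Suc (Suc n)) = cf_error x (Suc n) * (1 / f - \<lfloor>1 / f\<rfloor>)"
    using rem by (simp add: cf_error_def frac_def[of "1 / f"] del: cf_rem.simps)
  show ?thesis
    using f unfolding 2 1 cf_quot_def rem by (simp add: field_simps)
qed

lemma cf_denom_error:
  assumes "x \<notin> \<rat>"
  shows "\<exists>p::int. real_of_int (cf_denom x n) * x - real_of_int p = (-1) ^ n * cf_error x n"
proof (induction n rule: less_induct)
  case (less n)
  consider "n = 0" | "n = 1" | k where "n = Suc (Suc k)"
    by (metis One_nat_def not0_implies_Suc)
  then show ?case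
  proof cases
    case 1
    then show ?thesis by (intro exI[of _ "\<lfloor>x\<rfloor>"]) (simp add: cf_error_def frac_def)
  next
    case 2
    then show ?thesis
      using cf_error_1[OF assms]
      by (intro exI[of _ "cf_quot x 1 * \<lfloor>x\<rfloor> + 1"])
         (simp add: cf_error_def frac_def[of x] algebra_simps)
  next
    case 3
    obtain p p' :: int where
      p: "real_of_int (cf_denom x k) * x - p = (-1) ^ k * cf_error x k" and
      p': "real_of_int (cf_denom x (Suc k)) * x - p' = (-1) ^ Suc k * cf_error x (Suc k)"
      using less[of k] less[of "Suc k"] 3 by auto
    define a where "a = real_of_int (cf_quot x n)"
    have "real_of_int (cf_denom x n) * x - (a * p' + p)
        = a * (real_of_int (cf_denom x (Suc k)) * x - p') + (real_of_int (cf_denom x k) * x - p)"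
      using 3 by (simp add: a_def algebra_simps)
    also have "\<dots> = (-1) ^ n * (cf_error x k - a * cf_error x (Suc k))"
      unfolding p p' using 3 by (simp add: algebra_simps)
    also have "\<dots> = (-1) ^ n * cf_error x n"
      using cf_error_recurrence[OF assms, of k] 3 by (simp add: a_def)
    finally show ?thesis
      by (intro exI[of _ "cf_quot x n * p' + p"]) (simp add: a_def)
  qed
qed

text \<open>This is the determinant identity \<open>p (n + 1) * q n - p n * q (n + 1) = \<plusminus> 1\<close> in terms of errors.
  It is invariant because \<open>q\<close> and the error satisfy the same recurrence, up to signs.\<close>

lemma cf_error_denom_identity:
  assumes "x \<notin> \<rat>"
  shows "cf_error x n * cf_denom x (Suc n) + cf_error x (Suc n) * cf_denom x n = 1"
proof (induction n)
  case 0
  then show ?case using cf_error_1[OF assms] by simp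
next
  case (Suc n)
  then show ?case
    by (simp add: cf_error_recurrence[OF assms, of n] algebra_simps)
qed

lemma convergent_approximation:
  assumes "x \<notin> \<rat>"
  obtains p :: int where
    "\<bar>real_of_int (cf_denom x n) * x - real_of_int p\<bar> \<le> 1 / real_of_int (cf_denom x (Suc n))"
proof -
  obtain p :: int where
    p: "real_of_int (cf_denom x n) * x - real_of_int p = (-1) ^ n * cf_error x n"
    using cf_denom_error[OF assms] by blast
  have q: "cf_denom x n \<ge> 1" "cf_denom x (Suc n) \<ge> 1"
    using cf_denom_lower_bound[OF assms] by auto
  have "0 \<le> cf_error x (Suc n) * cf_denom x n"
    using q by (intro mult_nonneg_nonneg cf_error_nonneg) auto
  then have "cf_error x n * cf_denom x (Suc n) \<le> 1"
    using cf_error_denom_identity[OF assms, of n] by linarith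
  then have "cf_error x n \<le> 1 / cf_denom x (Suc n)"
    using q by (simp add: field_simps)
  moreover have "\<bar>(-1) ^ n * cf_error x n\<bar> = cf_error x n"
    using cf_error_nonneg by (simp add: abs_mult)
  ultimately show thesis using that[of p] p by simp
qed


section \<open>Points that visit a ball early\<close>

lemma rotation_near_short_orbit:
  fixes a Q :: real and p :: int
  assumes "q \<ge> 1" and "Q > 0" and "\<bar>real q * a - real_of_int p\<bar> \<le> 1 / Q" and "real n \<le> N"
  shows "int_dist (real n * a - real (n mod q) * a) \<le> N / (real q * Q)"
proof -
  define m where "m = n div q"
  have n: "real n = real m * real q + real (n mod q)"
    unfolding m_def by (metis div_mult_mod_eq of_nat_add of_nat_mult)
  have m: "real m \<le> N / real q"
    using n assms by (simp add: field_simps)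
  have "int_dist (real n * a - real (n mod q) * a) \<le> \<bar>real m * real q * a - of_int (int m * p)\<bar>"
    using int_dist_le[of "real m * real q * a" "int m * p"] by (simp add: n algebra_simps)
  also have "real m * real q * a - of_int (int m * p) = real m * (real q * a - p)"
    by (simp add: algebra_simps)
  also have "\<bar>real m * (real q * a - p)\<bar> = real m * \<bar>real q * a - p\<bar>"
    by (simp add: abs_mult)
  also have "\<dots> \<le> N / real q * (1 / Q)"
    using assms m by (intro mult_mono) auto
  finally show ?thesis by simp
qed

text \<open>An arc of radius \<open>\<rho>\<close> meets the fundamental domain in at most two intervals of radius \<open>\<rho>\<close>,
  because the integer nearest to \<open>t - c\<close> takes at most two values as \<open>t\<close> ranges over it.\<close>

lemma arcs_cover:
  fixes c :: "nat \<Rightarrow> real"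
  assumes "\<rho> \<ge> 0"
  obtains A where "A \<in> sets borel" and "emeasure lborel A \<le> ennreal (4 * real q * \<rho>)"
    and "{t \<in> {0..<1}. \<exists>u<q. int_dist (t - c u) < \<rho>} \<subseteq> A"
proof -
  define J where "J u = {c u + round (- c u) - \<rho>..c u + round (- c u) + \<rho>} \<union>
      {c u + round (- c u) + 1 - \<rho>..c u + round (- c u) + 1 + \<rho>}" for u
  define A where "A = (\<Union>u<q. J u)"
  have J: "J u \<in> sets borel" for u by (simp add: J_def)
  have "emeasure lborel (J u) \<le> ennreal (4 * \<rho>)" for u
  proof -
    have "emeasure lborel (J u) \<le> ennreal (2 * \<rho>) + ennreal (2 * \<rho>)"
      unfolding J_def using assms
      by (intro order_trans[OF emeasure_subadditive] add_mono) auto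
    also have "\<dots> = ennreal (4 * \<rho>)"
      using assms by (simp flip: ennreal_plus)
    finally show ?thesis .
  qed
  then have "emeasure lborel A \<le> (\<Sum>u<q. ennreal (4 * \<rho>))"
    unfolding A_def using J
    by (intro order_trans[OF emeasure_subadditive_finite] sum_mono) auto
  also have "\<dots> = ennreal (4 * real q * \<rho>)"
    using assms by (simp add: ennreal_mult' ennreal_of_nat_eq_real_of_nat flip: ennreal_mult)
      (simp add: algebra_simps)
  finally have "emeasure lborel A \<le> ennreal (4 * real q * \<rho>)" .
  moreover have "{t \<in> {0..<1}. \<exists>u<q. int_dist (t - c u) < \<rho>} \<subseteq> A"
  proof clarify
    fix t u assume t: "t \<in> {0..<1::real}" "u < q" "int_dist (t - c u) < \<rho>"
    have "round (- c u) \<le> round (t - c u)" "round (t - c u) \<le> round (- c u) + 1"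
      using t by (auto simp: round_def intro: floor_mono) linarith
    then have "round (t - c u) = round (- c u) \<or> round (t - c u) = round (- c u) + 1"
      by linarith
    then have "t \<in> J u"
      using t(3) by (auto simp: J_def int_dist_def)
    then show "t \<in> A" using t by (auto simp: A_def)
  qed
  moreover have "A \<in> sets borel" using J by (auto simp: A_def)
  ultimately show thesis using that by blast
qed

lemma dist_torus_proj:
  "dist (torus_proj x) (torus_proj y) = max (int_dist (fst x - fst y)) (int_dist (snd x - snd y))"
  by transfer simp

lemma torus_proj_surj: "\<exists>z. torus_proj z = x"
  by transfer (meson equivp_reflp equivp_torus_rel)

lemma translation_torus_proj: "translation v (torus_proj z) = torus_proj (z + v)"
  by transfer (simp add: torus_rel_def)

lemma translation_funpow_torus_proj:
  "(translation v ^^ n) (torus_proj z) = torus_proj (z + real n *\<^sub>R v)"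
  by (induction n) (simp_all add: translation_torus_proj algebra_simps)

definition visitors :: "('a::metric_space \<Rightarrow> 'a) \<Rightarrow> 'a \<Rightarrow> real \<Rightarrow> real \<Rightarrow> 'a set" where
  "visitors T x0 r N = {x. \<exists>n. real n \<le> N \<and> (T ^^ n) x \<in> ball x0 r}"

lemma open_visitors_translation: "open (visitors (translation v) x0 r N)"
proof -
  obtain z0 where z0: "x0 = torus_proj z0" using torus_proj_surj by metis
  have "dist x0 ((translation v ^^ n) x) = dist (torus_proj (z0 - real n *\<^sub>R v)) x" for n x
    using torus_proj_surj[of x] unfolding z0
    by (auto simp: translation_funpow_torus_proj dist_torus_proj algebra_simps)
  then have "visitors (translation v) x0 r N =
      (\<Union>n\<in>{n. real n \<le> N}. ball (torus_proj (z0 - real n *\<^sub>R v)) r)"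
    by (auto simp: visitors_def)
  then show ?thesis by auto
qed

text \<open>A visitor is confined, in the coordinate \<open>\<pi>\<close>, to \<open>q\<close> arcs of radius \<open>r + N / (q * Q)\<close>: the
  radius of the ball plus the drift of the orbit away from its first \<open>q\<close> points.\<close>

lemma measure_visitors_le:
  fixes \<pi> :: "real \<times> real \<Rightarrow> real" and p :: int
  assumes \<pi>: "\<pi> = fst \<or> \<pi> = snd"
    and q: "q \<ge> 1" and Q: "Q > 0" and approx: "\<bar>real q * \<pi> v - real_of_int p\<bar> \<le> 1 / Q"
    and r: "r \<ge> 0" and N: "N \<ge> 0"
  shows "measure torus_lebesgue (visitors (translation v) x0 r N) \<le> 4 * (real q * r + N / Q)"
proof -
  obtain z0 where z0: "x0 = torus_proj z0" using torus_proj_surj by metis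
  define \<rho> where "\<rho> = r + N / (real q * Q)"
  have \<rho>: "\<rho> \<ge> 0" using q Q r N by (simp add: \<rho>_def)
  have lin: "\<pi> (x + y) = \<pi> x + \<pi> y" "\<pi> (c *\<^sub>R x) = c * \<pi> x" for x y c
    using \<pi> by auto
  obtain A where A: "A \<in> sets borel" "emeasure lborel A \<le> ennreal (4 * real q * \<rho>)"
    "{t \<in> {0..<1}. \<exists>u<q. int_dist (t - (\<pi> z0 - real u * \<pi> v)) < \<rho>} \<subseteq> A"
    by (rule arcs_cover[OF \<rho>])
  let ?S = "{0..<1::real} \<times> {0..<1::real}"
  let ?V = "visitors (translation v) x0 r N"
  define B where "B = (if \<pi> = fst then A \<times> {0..<1} else {0..<1} \<times> A)"
  have B: "B \<in> sets borel"
    using A(1) by (auto simp: B_def intro!: borel_Times)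
  have emB: "emeasure lborel B = emeasure lborel A"
    using A(1) by (simp add: B_def lborel_prod[symmetric] lborel.emeasure_pair_measure_Times)
  have sub: "torus_proj -` ?V \<inter> ?S \<subseteq> B"
  proof
    fix z assume z: "z \<in> torus_proj -` ?V \<inter> ?S"
    then obtain n where n: "real n \<le> N" "dist x0 (torus_proj (z + real n *\<^sub>R v)) < r"
      by (auto simp: visitors_def translation_funpow_torus_proj)
    have "int_dist (\<pi> (z + real n *\<^sub>R v) - \<pi> z0) < r"
      using n(2) \<pi> unfolding z0 by (subst (asm) dist_commute) (auto simp: dist_torus_proj)
    moreover have eq: "\<pi> z - (\<pi> z0 - real (n mod q) * \<pi> v) =
        (\<pi> (z + real n *\<^sub>R v) - \<pi> z0) + - (real n * \<pi> v - real (n mod q) * \<pi> v)"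
      by (simp add: lin)
    ultimately have "int_dist (\<pi> z - (\<pi> z0 - real (n mod q) * \<pi> v)) < \<rho>"
      using int_dist_triangle[of "\<pi> (z + real n *\<^sub>R v) - \<pi> z0"
          "- (real n * \<pi> v - real (n mod q) * \<pi> v)"]
        rotation_near_short_orbit[OF q Q approx n(1)]
      unfolding \<rho>_def eq int_dist_minus by linarith
    moreover have "n mod q < q" using q by simp
    moreover have "\<pi> z \<in> {0..<1}" using z \<pi> by auto
    ultimately have "\<pi> z \<in> A" using A(3) by blast
    then show "z \<in> B" using z \<pi> by (auto simp: B_def)
  qed
  have V: "?V \<in> sets borel" using open_visitors_translation by auto
  have S: "?S \<in> sets borel" by (intro borel_Times) auto
  have "emeasure torus_lebesgue ?V = emeasure lborel (torus_proj -` ?V \<inter> ?S)"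
    unfolding torus_lebesgue_def using S V
    by (simp add: emeasure_distr measurable_torus_proj emeasure_restrict_space space_restrict_space)
  also have "\<dots> \<le> emeasure lborel B"
    using B sub by (intro emeasure_mono) auto
  also have "\<dots> \<le> ennreal (4 * real q * \<rho>)" using A emB by simp
  also have "4 * real q * \<rho> = 4 * (real q * r + N / Q)"
    using q Q by (simp add: \<rho>_def field_simps)
  finally show ?thesis
    using q Q r N unfolding measure_def by (intro enn2real_leI) auto
qed


section \<open>Interlacing denominators\<close>

text \<open>If \<open>y\<close> lies in \<open>[q n, q (n + 1))\<close>, then \<open>q' n\<close> cuts this interval in two, and the part
  containing \<open>y\<close> decides which of the two sequences jumps past \<open>y powr \<gamma>\<close>.\<close>

lemma scale_between_denominators:
  fixes q q' :: "nat \<Rightarrow> real"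
  assumes "\<gamma> \<ge> 0" and unbounded: "filterlim q at_top sequentially"
    and "\<forall>\<^sub>F n in sequentially. q' n \<ge> q n powr \<gamma> \<and> q (n + 1) \<ge> q' n powr \<gamma>"
  shows "\<forall>\<^sub>F y in at_top. (\<exists>n. q n \<le> y \<and> y powr \<gamma> \<le> q (n + 1)) \<or>
    (\<exists>n. q' n \<le> y \<and> y powr \<gamma> \<le> q' (n + 1))"
proof -
  obtain n0 where n0: "q' n \<ge> q n powr \<gamma>" "q (n + 1) \<ge> q' n powr \<gamma>" if "n \<ge> n0" for n
    using assms(3) unfolding eventually_sequentially by blast
  show ?thesis
    using eventually_ge_at_top[of "max 0 (q n0)"]
  proof eventually_elim
    case (elim y)
    have "\<forall>\<^sub>F n in sequentially. n \<ge> n0 \<and> q n > y"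
      using unbounded eventually_ge_at_top[of n0]
      by (auto simp: filterlim_at_top_dense eventually_conj_iff)
    then have ex: "\<exists>n. n \<ge> n0 \<and> q n > y"
      by (auto simp: eventually_sequentially)
    \<comment> \<open>The least index from \<open>n0\<close> on avoids any appeal to monotonicity of \<open>q\<close>.\<close>
    define m where "m = (LEAST n. n \<ge> n0 \<and> q n > y)"
    have m: "m \<ge> n0" "q m > y" using LeastI_ex[OF ex] by (auto simp: m_def)
    have "m \<noteq> n0" using m(2) elim by auto
    then obtain n where n: "m = Suc n" "n \<ge> n0" using m(1) by (cases m) auto
    have "q n \<le> y"
      using not_less_Least[of n "\<lambda>n. n \<ge> n0 \<and> q n > y"] n unfolding m_def by auto
    moreover have "y powr \<gamma> \<le> q (n + 1)" if "y < q' n"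
      using powr_mono2[of \<gamma> y "q' n"] that elim assms(1) n0(2)[OF n(2)] by auto
    moreover have "y powr \<gamma> \<le> q' (n + 1)"
      using powr_mono2[of \<gamma> y "q (n + 1)"] elim assms(1) n0(1)[of "n + 1"] n m(2) by auto
    ultimately show ?case by (meson not_less)
  qed
qed

lemma filterlim_cf_denom:
  assumes "x \<notin> \<rat>"
  shows "filterlim (\<lambda>n. real_of_int (cf_denom x n)) at_top sequentially"
proof (rule filterlim_at_top_mono[OF filterlim_real_sequentially])
  show "\<forall>\<^sub>F n in sequentially. real n \<le> real_of_int (cf_denom x n)"
    using cf_denom_lower_bound[OF assms] by (intro always_eventually) (metis of_int_le_iff of_int_of_nat_eq)
qed


section \<open>Hitting times at dyadic scales\<close>

lemma measure_visitors_convergent_le: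
  assumes \<pi>: "\<pi> = fst \<or> \<pi> = snd" and irr: "\<pi> v \<notin> \<rat>" and y: "y > 0"
    and n: "real_of_int (cf_denom (\<pi> v) n) \<le> y"
      "y powr \<gamma> \<le> real_of_int (cf_denom (\<pi> v) (n + 1))"
  shows "measure torus_lebesgue (visitors (translation v) x0 (y powr - s) (y powr t))
    \<le> 4 * (y powr (1 - s) + y powr (t - \<gamma>))"
proof -
  define q where "q = nat (cf_denom (\<pi> v) n)"
  have q: "q \<ge> 1" "real q = real_of_int (cf_denom (\<pi> v) n)"
    using cf_denom_lower_bound[OF irr, of n] by (auto simp: q_def)
  obtain p :: int where
    "\<bar>real q * \<pi> v - real_of_int p\<bar> \<le> 1 / real_of_int (cf_denom (\<pi> v) (n + 1))"
    using convergent_approximation[OF irr, of n] q by auto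
  moreover have "1 / real_of_int (cf_denom (\<pi> v) (n + 1)) \<le> 1 / y powr \<gamma>"
    using n(2) y cf_denom_lower_bound[OF irr, of "n + 1"] by (intro divide_left_mono) auto
  ultimately have "\<bar>real q * \<pi> v - real_of_int p\<bar> \<le> 1 / y powr \<gamma>" by linarith
  then have "measure torus_lebesgue (visitors (translation v) x0 (y powr - s) (y powr t))
      \<le> 4 * (real q * y powr - s + y powr t / y powr \<gamma>)"
    using y q by (intro measure_visitors_le[OF \<pi>]) auto
  also have "\<dots> \<le> 4 * (y * y powr - s + y powr t / y powr \<gamma>)"
    using q n by (intro mult_left_mono add_right_mono mult_right_mono) auto
  also have "\<dots> = 4 * (y powr (1 - s) + y powr (t - \<gamma>))"
    using y powr_add[of y 1 "- s"] by (simp add: powr_diff)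
  finally show ?thesis .
qed

lemma AE_not_in_visitors:
  fixes \<alpha> \<alpha>' \<gamma> s t :: real
  assumes irr: "\<alpha> \<notin> \<rat>" "\<alpha>' \<notin> \<rat>" and "\<gamma> > 1"
    and ev: "\<forall>\<^sub>F n in sequentially.
      real_of_int (cf_denom \<alpha>' n) \<ge> real_of_int (cf_denom \<alpha> n) powr \<gamma> \<and>
      real_of_int (cf_denom \<alpha> (n + 1)) \<ge> real_of_int (cf_denom \<alpha>' n) powr \<gamma>"
    and s: "s > 1" and t: "t < \<gamma>"
  shows "AE x in torus_lebesgue. \<forall>\<^sub>F k in sequentially.
    x \<notin> visitors (translation (\<alpha>, \<alpha>')) x0 (2 powr (- s * real k)) (2 powr (t * real k))"
proof -
  define E where "E k = visitors (translation (\<alpha>, \<alpha>')) x0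
    (2 powr (- s * real k)) (2 powr (t * real k))" for k
  have sets: "E k \<in> sets torus_lebesgue" for k
    using open_visitors_translation by (auto simp: torus_lebesgue_def E_def)
  have fin: "emeasure torus_lebesgue (E k) < \<infinity>" for k
  proof -
    have "emeasure torus_lebesgue (E k) \<le> emeasure torus_lebesgue UNIV"
      by (intro emeasure_mono) (auto simp: torus_lebesgue_def)
    also have "\<dots> < \<infinity>" by (simp add: emeasure_torus_lebesgue_UNIV)
    finally show ?thesis .
  qed
  have "0 \<le> \<gamma>" using \<open>\<gamma> > 1\<close> by simp
  have "\<forall>\<^sub>F y in at_top. measure torus_lebesgue
      (visitors (translation (\<alpha>, \<alpha>')) x0 (y powr - s) (y powr t))
      \<le> 4 * (y powr (1 - s) + y powr (t - \<gamma>))"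
    using scale_between_denominators[OF \<open>0 \<le> \<gamma>\<close> filterlim_cf_denom[OF irr(1)] ev]
      eventually_gt_at_top[of 0]
  proof eventually_elim
    case (elim y)
    then show ?case
      using measure_visitors_convergent_le[of fst "(\<alpha>, \<alpha>')" y]
        measure_visitors_convergent_le[of snd "(\<alpha>, \<alpha>')" y] irr by auto
  qed
  moreover have "filterlim (\<lambda>k. 2 powr real k :: real) at_top sequentially"
  proof (rule filterlim_at_top_mono[OF filterlim_real_sequentially])
    show "\<forall>\<^sub>F k in sequentially. real k \<le> 2 powr real k"
      by (simp add: powr_realpow less_imp_le[OF of_nat_less_two_power])
  qed
  ultimately have "\<forall>\<^sub>F k in sequentially. measure torus_lebesgue
      (visitors (translation (\<alpha>, \<alpha>')) x0 ((2 powr real k) powr - s) ((2 powr real k) powr t))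
      \<le> 4 * ((2 powr real k) powr (1 - s) + (2 powr real k) powr (t - \<gamma>))"
    by (rule eventually_compose_filterlim)
  then have bound: "\<forall>\<^sub>F k in sequentially. norm (measure torus_lebesgue (E k))
      \<le> 4 * ((2 powr (1 - s)) ^ k + (2 powr (t - \<gamma>)) ^ k)"
    by eventually_elim (simp add: E_def powr_powr powr_power algebra_simps)
  have "(2::real) powr (1 - s) < 2 powr 0" "(2::real) powr (t - \<gamma>) < 2 powr 0"
    using s t by (intro powr_less_mono; simp)+
  then have "summable (\<lambda>k. 4 * (((2::real) powr (1 - s)) ^ k + (2 powr (t - \<gamma>)) ^ k))"
    by (intro summable_mult summable_add summable_geometric) auto
  then have "summable (\<lambda>k. measure torus_lebesgue (E k))"
    using bound by (rule summable_comparison_test_ev[rotated])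
  from borel_cantelli_AE1[OF sets fin this] show ?thesis
    by (rule AE_mp) (auto simp: E_def elim: eventually_mono)
qed

text \<open>Every small radius \<open>r\<close> lies between \<open>2 powr (- s * (k + 1))\<close> and \<open>2 powr (- s * k)\<close> for
  some large \<open>k\<close>. The hitting time at \<open>r\<close> is at least that at the larger radius, hence more than
  \<open>2 powr (t * k)\<close>, and this exceeds \<open>r powr - \<beta>\<close> because \<open>\<beta> * s < t\<close> absorbs the shift by one.\<close>

lemma lower_hitting_exponent_ge:
  fixes T :: "'a::metric_space \<Rightarrow> 'a"
  assumes "\<beta> > 0" and "s > 0" and "\<beta> * s < t"
    and ev: "\<forall>\<^sub>F k in sequentially.
      x \<notin> visitors T x0 (2 powr (- s * real k)) (2 powr (t * real k))"
  shows "lower_hitting_exponent T x x0 \<ge> ereal \<beta>"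
proof (cases "\<forall>r>0. hits T r x x0")
  case False
  then show ?thesis unfolding lower_hitting_exponent_def if_not_P[OF False] by simp
next
  case hits: True
  obtain K where K: "x \<notin> visitors T x0 (2 powr (- s * real k)) (2 powr (t * real k))"
    if "k \<ge> K" for k
    using ev unfolding eventually_sequentially by blast
  obtain L :: nat where L: "real L \<ge> \<beta> * s / (t - \<beta> * s)"
    using real_arch_simple by blast
  define \<delta> where "\<delta> = (2::real) powr (- s * real (K + L + 1))"
  have "\<delta> > 0" by (simp add: \<delta>_def)
  then have "\<forall>\<^sub>F r in at_right 0. r \<in> {0<..<\<delta>}"
    by (rule eventually_at_right_real)
  then have "\<forall>\<^sub>F r in at_right 0.
      ereal \<beta> \<le> ereal (ln (real (hitting_time T r x x0)) / (- ln r))"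
  proof eventually_elim
    case (elim r)
    define k where "k = nat \<lfloor>- log 2 r / s\<rfloor>"
    have r: "0 < r" "r < \<delta>" using elim by auto
    have "log 2 r < log 2 \<delta>" using r by simp
    then have "log 2 r < - s * real (K + L + 1)" by (simp add: \<delta>_def)
    then have large: "real (K + L + 1) < - log 2 r / s"
      using \<open>s > 0\<close> by (simp add: field_simps)
    then have k: "real k \<le> - log 2 r / s" "- log 2 r / s < real k + 1"
      unfolding k_def by linarith+
    have kge: "k \<ge> K" "k \<ge> L" using k(2) large by linarith+
    define n where "n = hitting_time T r x x0"
    have "\<exists>n. n \<ge> 1 \<and> (T ^^ n) x \<in> ball x0 r"
      using hits r by (auto simp: hits_def)
    then have n: "n \<ge> 1" "(T ^^ n) x \<in> ball x0 r"
      unfolding n_def hitting_time_def by (metis (mono_tags, lifting) LeastI_ex)+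
    have "log 2 r \<le> - s * real k" using k(1) \<open>s > 0\<close> by (simp add: field_simps)
    then have "r \<le> 2 powr (- s * real k)" using r by (simp add: log_le_iff)
    then have "(T ^^ n) x \<in> ball x0 (2 powr (- s * real k))"
      using n(2) by auto
    then have "2 powr (t * real k) < real n"
      using K[OF kge(1)] unfolding visitors_def by (auto simp: not_le)
    then have "log 2 (2 powr (t * real k)) < log 2 (real n)"
      using n by (subst log_less_cancel_iff) auto
    then have "t * real k < log 2 (real n)" by simp
    moreover have "\<beta> * s * (real k + 1) \<le> t * real k"
    proof -
      have "\<beta> * s / (t - \<beta> * s) \<le> real k" using L kge by linarith
      then show ?thesis using assms(3) by (simp add: field_simps)
    qed
    moreover have "\<beta> * (- log 2 r) \<le> \<beta> * (s * (real k + 1))"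
      using k(2) \<open>s > 0\<close> \<open>\<beta> > 0\<close> by (intro mult_left_mono) (auto simp: field_simps)
    ultimately have "\<beta> * (- log 2 r) \<le> log 2 (real n)" by (simp add: mult.assoc)
    then have "\<beta> * (- ln r) \<le> ln (real n)"
      by (simp add: log_def field_simps)
    moreover have "- ln r > 0"
    proof -
      have "- log 2 r / s > 0" using large by linarith
      then have "log 2 r < 0" using \<open>s > 0\<close> by (simp add: field_simps)
      then show ?thesis using r by simp
    qed
    ultimately show ?case by (simp add: n_def field_simps)
  qed
  then show ?thesis
    using hits unfolding lower_hitting_exponent_def by (auto intro: Liminf_bounded)
qed

theorem theoremA:
  fixes \<alpha> \<alpha>' \<gamma> :: real
  assumes "\<alpha> \<notin> \<rat>" and "\<alpha>' \<notin> \<rat>" and "\<gamma> > 1"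
    and "\<forall>\<^sub>F n in sequentially.
      real_of_int (cf_denom \<alpha>' n) \<ge> real_of_int (cf_denom \<alpha> n) powr \<gamma> \<and>
      real_of_int (cf_denom \<alpha> (n + 1)) \<ge> real_of_int (cf_denom \<alpha>' n) powr \<gamma>"
  shows "\<forall>x0 :: torus. AE x in torus_lebesgue.
    lower_hitting_exponent (translation (\<alpha>, \<alpha>')) x x0 \<ge> ereal \<gamma>"
proof
  fix x0 :: torus
  let ?h = "\<lambda>x. lower_hitting_exponent (translation (\<alpha>, \<alpha>')) x x0"
  have below: "AE x in torus_lebesgue. ?h x \<ge> ereal \<beta>" if \<beta>: "0 < \<beta>" "\<beta> < \<gamma>" for \<beta>
  proof -
    obtain t where t: "\<beta> < t" "t < \<gamma>" using dense[OF \<beta>(2)] by blast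
    have "1 < t / \<beta>" using t \<beta> by simp
    then obtain s where s: "1 < s" "s < t / \<beta>" using dense by blast
    have "\<beta> * s < t" using s \<beta> by (simp add: field_simps)
    then show ?thesis
      using AE_not_in_visitors[OF assms s(1) t(2), of x0]
        lower_hitting_exponent_ge[of \<beta> s t] \<beta> s(1)
      by (auto elim!: eventually_mono)
  qed
  have "AE x in torus_lebesgue. \<forall>m::nat. ?h x \<ge> ereal (\<gamma> - 1 / real (Suc m))"
    unfolding AE_all_countable
  proof
    fix m :: nat
    have "0 < \<gamma> - 1 / real (Suc m)"
      using \<open>\<gamma> > 1\<close> by (simp add: field_simps) (smt (verit) of_nat_0_le_iff mult_nonneg_nonneg)
    then show "AE x in torus_lebesgue. ?h x \<ge> ereal (\<gamma> - 1 / real (Suc m))"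
      by (rule below) simp
  qed
  then show "AE x in torus_lebesgue. ?h x \<ge> ereal \<gamma>"
  proof eventually_elim
    case (elim x)
    have "(\<lambda>m. \<gamma> - 1 / real (Suc m)) \<longlonglongrightarrow> \<gamma> - 0"
      by (intro tendsto_intros LIMSEQ_Suc[OF lim_1_over_n])
    then have lim: "(\<lambda>m. ereal (\<gamma> - 1 / real (Suc m))) \<longlonglongrightarrow> ereal \<gamma>" by simp
    show ?case
      using elim by (intro LIMSEQ_le_const2[OF lim]) blast
  qed
qed

end
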